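(* Let $R$ be a commutative ring with identity, let $S$ be a multiplicative subset of $R$, and let $M$ be an $S$-faithful $R$-module (for example, a faithful $R$-module). If $M$ is an $S$-Noetherian $R$-module, then $R$ is an $S$-Noetherian ring.
   Context: All rings are commutative with identity and all modules are unitary. A multiplicative subset $S$ of $R$ is a subset with $1\in S$ and $s_1s_2\in S$ for all $s_1,s_2\in S$. $\operatorname{Ann}_R(M)=\{r\in R\mid rM=0\}$; $M$ is faithful if $\operatorname{Ann}_R(M)=0$. An $R$-module $M$ is $S$-faithful if $t\operatorname{Ann}_R(M)=0$ for some $t\in S$. An $R$-module $N$ is $S$-finite if there are an element $s\in S$ and a finitely generated $R$-submodule $F$ of $N$ with $sN\subseteq F\subseteq N$. An $R$-module $M$ is $S$-Noetherian if every submodule of $M$ is $S$-finite (the element $s$ may depend on the submodule). The ring $R$ is an $S$-Noetherian ring if $R$ is $S$-Noetherian as an $R$-module. *)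

theory Defs
  imports "HOL-Algebra.Module" "HOL-Algebra.Ideal"
begin

text \<open>
  A multiplicative subset \<open>S\<close> of \<open>R\<close> is expressed by the library predicate \<open>submonoid S R\<close>:
  \<open>S \<subseteq> carrier R\<close>, \<open>\<one> \<in> S\<close>, and \<open>S\<close> is closed under multiplication.  A submodule \<open>N\<close> of \<open>M\<close>,
  regarded as a module in its own right, is \<open>M\<lparr>carrier := N\<rparr>\<close>
  (see \<open>submodule.submodule_is_module\<close>).  The predicates below are meant for \<open>module R M\<close>,
  which is not repeated in their definitions.
\<close>

definition annihilator :: "('a, 'c) ring_scheme \<Rightarrow> ('a, 'b, 'd) module_scheme \<Rightarrow> 'a set" where
  "annihilator R M = {r \<in> carrier R. \<forall>x\<in>carrier M. r \<odot>\<^bsub>M\<^esub> x = \<zero>\<^bsub>M\<^esub>}"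

definition faithful :: "('a, 'c) ring_scheme \<Rightarrow> ('a, 'b, 'd) module_scheme \<Rightarrow> bool" where
  "faithful R M \<longleftrightarrow> annihilator R M = {\<zero>\<^bsub>R\<^esub>}"

definition S_faithful ::
  "('a, 'c) ring_scheme \<Rightarrow> 'a set \<Rightarrow> ('a, 'b, 'd) module_scheme \<Rightarrow> bool" where
  "S_faithful R S M \<longleftrightarrow> (\<exists>t\<in>S. (\<lambda>r. t \<otimes>\<^bsub>R\<^esub> r) ` annihilator R M = {\<zero>\<^bsub>R\<^esub>})"

text \<open>The submodule generated by a subset, in analogy to \<open>genideal\<close>.\<close>

definition genmodule ::
  "('a, 'c) ring_scheme \<Rightarrow> ('a, 'b, 'd) module_scheme \<Rightarrow> 'b set \<Rightarrow> 'b set" where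
  "genmodule R M A = \<Inter>{N. submodule N R M \<and> A \<subseteq> N}"

definition finitely_generated ::
  "('a, 'c) ring_scheme \<Rightarrow> ('a, 'b, 'd) module_scheme \<Rightarrow> bool" where
  "finitely_generated R M \<longleftrightarrow>
     (\<exists>A. finite A \<and> A \<subseteq> carrier M \<and> genmodule R M A = carrier M)"

definition S_finite ::
  "('a, 'c) ring_scheme \<Rightarrow> 'a set \<Rightarrow> ('a, 'b, 'd) module_scheme \<Rightarrow> bool" where
  "S_finite R S N \<longleftrightarrow>
     (\<exists>s\<in>S. \<exists>F. submodule F R N \<and> finitely_generated R (N\<lparr>carrier := F\<rparr>) \<and>
        (\<lambda>x. s \<odot>\<^bsub>N\<^esub> x) ` carrier N \<subseteq> F)"

definition S_noetherian_module ::
  "('a, 'c) ring_scheme \<Rightarrow> 'a set \<Rightarrow> ('a, 'b, 'd) module_scheme \<Rightarrow> bool" where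
  "S_noetherian_module R S M \<longleftrightarrow> (\<forall>N. submodule N R M \<longrightarrow> S_finite R S (M\<lparr>carrier := N\<rparr>))"

text \<open>The ring \<open>R\<close> as a module over itself.\<close>

definition ring_as_module :: "('a, 'c) ring_scheme \<Rightarrow> ('a, 'a) module" where
  "ring_as_module R =
     \<lparr>carrier = carrier R, monoid.mult = monoid.mult R, one = one R,
      zero = zero R, add = add R, smult = monoid.mult R\<rparr>"

definition S_noetherian_ring :: "('a, 'c) ring_scheme \<Rightarrow> 'a set \<Rightarrow> bool" where
  "S_noetherian_ring R S \<longleftrightarrow> S_noetherian_module R S (ring_as_module R)"

lemma ring_as_module_simps [simp]:
  "carrier (ring_as_module R) = carrier R"
  "monoid.mult (ring_as_module R) = monoid.mult R"
  "one (ring_as_module R) = one R"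
  "zero (ring_as_module R) = zero R"
  "add (ring_as_module R) = add R"
  "smult (ring_as_module R) = monoid.mult R"
  by (simp_all add: ring_as_module_def)

lemma (in cring) module_ring_as_module: "module R (ring_as_module R)"
proof (rule moduleI)
  show "cring R" by (rule is_cring)
  show "abelian_group (ring_as_module R)"
  proof (rule abelian_groupI)
    fix x assume "x \<in> carrier (ring_as_module R)"
    then show "\<exists>y\<in>carrier (ring_as_module R). y \<oplus>\<^bsub>ring_as_module R\<^esub> x = \<zero>\<^bsub>ring_as_module R\<^esub>"
      by (intro bexI[of _ "\<ominus> x"]) (simp_all add: l_neg)
  qed (simp_all add: a_ac)
qed (simp_all add: l_distr r_distr m_assoc)

lemma (in cring) submodule_ring_as_module_iff: "submodule I R (ring_as_module R) \<longleftrightarrow> ideal I R"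
proof -
  interpret RM: module R "ring_as_module R" by (rule module_ring_as_module)
  have eq: "subgroup I (add_monoid (ring_as_module R)) \<longleftrightarrow> subgroup I (add_monoid R)"
    by (simp add: subgroup_def m_inv_def)
  show ?thesis
  proof
    assume I: "submodule I R (ring_as_module R)"
    then interpret I: submodule I R "ring_as_module R" .
    have sub: "I \<subseteq> carrier R" using RM.submoduleE(1)[OF I] by simp
    have cl: "a \<otimes> x \<in> I" if "a \<in> carrier R" "x \<in> I" for a x
      using I.smult_closed[OF that] by simp
    show "ideal I R"
    proof (rule idealI)
      show "ring R" by (rule ring_axioms)
      show "subgroup I (add_monoid R)" using I.subgroup_axioms eq by simp
      fix a x assume ax: "a \<in> I" "x \<in> carrier R"
      then show xa: "x \<otimes> a \<in> I" by (intro cl)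
      have "a \<otimes> x = x \<otimes> a" using ax sub by (intro m_comm) auto
      with xa show "a \<otimes> x \<in> I" by (simp only:)
    qed
  next
    assume "ideal I R"
    then interpret I: ideal I R .
    show "submodule I R (ring_as_module R)"
      unfolding submodule_def submodule_axioms_def eq
      using I.a_subgroup by (auto intro: I.I_l_closed)
  qed
qed

lemma (in module) genmodule_submodule:
  assumes "A \<subseteq> carrier M"
  shows "submodule (genmodule R M A) R M"
proof (rule submoduleI)
  show "genmodule R M A \<subseteq> carrier M"
    unfolding genmodule_def using assms carrier_is_submodule by blast
  have "\<zero>\<^bsub>M\<^esub> \<in> N" if "submodule N R M" for N
    using subgroup.one_closed[OF submodule.axioms(1)[OF that]] by simp
  then show "\<zero>\<^bsub>M\<^esub> \<in> genmodule R M A"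
    unfolding genmodule_def by blast
qed (unfold genmodule_def, (auto intro: submoduleE(3-5)))

lemma (in module) faithful_imp_S_faithful:
  assumes "faithful R M" and "submonoid S R"
  shows "S_faithful R S M"
proof -
  have "(\<lambda>r. \<one> \<otimes> r) ` annihilator R M = {\<zero>}"
    using assms(1) by (simp add: faithful_def)
  then show ?thesis
    unfolding S_faithful_def using submonoid.one_closed[OF assms(2)] by blast
qed

end

theory Submission
  imports Defs
begin

text \<open>
  Let \<open>s M \<subseteq> F\<close> with \<open>s \<in> S\<close> and \<open>F\<close> generated by \<open>x\<^sub>1, \<dots>, x\<^sub>n\<close>.  The ring map
  \<open>r \<mapsto> (r x\<^sub>1, \<dots>, r x\<^sub>n)\<close> into \<open>M\<^sup>n\<close> has kernel \<open>Ann F\<close>.  Since \<open>s Ann F \<subseteq> Ann M\<close>, the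
  kernel is killed by the element \<open>t s\<close> of \<open>S\<close>, where \<open>t Ann M = 0\<close>.  The image of \<open>R\<close> in
  \<open>M\<^sup>n\<close> is \<open>S\<close>-Noetherian, hence every ideal \<open>I\<close> is \<open>S\<close>-finite modulo \<open>Ann F\<close>, and one
  further multiplication by \<open>t s\<close> removes the error term in \<open>Ann F\<close>.

  The power \<open>M\<^sup>n\<close> is not formed.  The lemma \<open>ideal_S_finite_modulo_annihilator\<close> states
  \<open>S\<close>-finiteness of \<open>I\<close> modulo the annihilator of a finite subset of \<open>M\<close> and is proved
  by adding one element \<open>m\<close> of \<open>M\<close> at a time.  What is left over from the previous elements is
  an ideal \<open>J\<close> that annihilates them, and the \<open>S\<close>-finiteness of the submodule \<open>J m\<close> of \<open>M\<close>
  handles \<open>m\<close>.  This is the usual argument that an extension of \<open>S\<close>-Noetherian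
  modules is \<open>S\<close>-Noetherian, carried out for \<open>M\<^sup>n\<close>.
\<close>

context module
begin

text \<open>Closure under negation comes for free from scalar multiplication by \<open>- 1\<close>.  In this form
  being a submodule does not refer to inverses, whose definition depends on the carrier and
  therefore changes between \<open>M\<close> and \<open>M\<lparr>carrier := N\<rparr>\<close>.\<close>

lemma submodule_iff:
  "submodule H R M \<longleftrightarrow> H \<subseteq> carrier M \<and> \<zero>\<^bsub>M\<^esub> \<in> H \<and>
     (\<forall>x\<in>H. \<forall>y\<in>H. x \<oplus>\<^bsub>M\<^esub> y \<in> H) \<and> (\<forall>a\<in>carrier R. \<forall>x\<in>H. a \<odot>\<^bsub>M\<^esub> x \<in> H)"
  (is "_ \<longleftrightarrow> ?closed")
proof
  assume H: "submodule H R M"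
  have "\<zero>\<^bsub>M\<^esub> \<in> H"
    using subgroup.one_closed[OF submodule.axioms(1)[OF H]] by simp
  then show ?closed
    using submoduleE(1,4,5)[OF H] by blast
next
  assume H: ?closed
  have "\<ominus>\<^bsub>M\<^esub> x \<in> H" if "x \<in> H" for x
  proof -
    have "(\<ominus> \<one>) \<odot>\<^bsub>M\<^esub> x = \<ominus>\<^bsub>M\<^esub> x"
      using H that by (subst smult_l_minus) auto
    moreover have "(\<ominus> \<one>) \<odot>\<^bsub>M\<^esub> x \<in> H"
      using H that by simp
    ultimately show ?thesis by simp
  qed
  then show "submodule H R M"
    using H by (intro submoduleI) auto
qed

lemma submodule_restrict_iff:
  assumes "submodule N R M"
  shows "submodule H R (M\<lparr>carrier := N\<rparr>) \<longleftrightarrow> submodule H R M \<and> H \<subseteq> N"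
proof -
  interpret N: module R "M\<lparr>carrier := N\<rparr>"
    by (rule submodule.submodule_is_module[OF assms module_axioms])
  show ?thesis
    unfolding submodule_iff N.submodule_iff using submoduleE(1)[OF assms] by auto
qed

lemma genmodule_minimal:
  assumes "submodule N R M" "A \<subseteq> N"
  shows "genmodule R M A \<subseteq> N"
  using assms unfolding genmodule_def by blast

lemma genmodule_self: "A \<subseteq> genmodule R M A"
  unfolding genmodule_def by blast

lemma genmodule_restrict:
  assumes N: "submodule N R M" and A: "A \<subseteq> N"
  shows "genmodule R (M\<lparr>carrier := N\<rparr>) A = genmodule R M A"
proof
  have "submodule (genmodule R M A) R M"
    using A submoduleE(1)[OF N] by (intro genmodule_submodule) blast
  then have "submodule (genmodule R M A) R (M\<lparr>carrier := N\<rparr>)"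
    using genmodule_minimal[OF N A] by (simp add: submodule_restrict_iff[OF N])
  then show "genmodule R (M\<lparr>carrier := N\<rparr>) A \<subseteq> genmodule R M A"
    using genmodule_self unfolding genmodule_def by blast
  show "genmodule R M A \<subseteq> genmodule R (M\<lparr>carrier := N\<rparr>) A"
    unfolding genmodule_def submodule_restrict_iff[OF N] by blast
qed

lemma finitely_generated_restrict_iff:
  assumes "submodule F R M"
  shows "finitely_generated R (M\<lparr>carrier := F\<rparr>) \<longleftrightarrow>
    (\<exists>A. finite A \<and> A \<subseteq> F \<and> genmodule R M A = F)"
  unfolding finitely_generated_def using genmodule_restrict[OF assms] by auto

text \<open>All spans are taken in the ambient module, so that \<open>S\<close>-finiteness of different submodules
  can be compared without passing between the restricted structures.\<close>

lemma S_finite_submodule_iff: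
  assumes N: "submodule N R M"
  shows "S_finite R S (M\<lparr>carrier := N\<rparr>) \<longleftrightarrow>
    (\<exists>s\<in>S. \<exists>A. finite A \<and> A \<subseteq> N \<and> (\<forall>x\<in>N. s \<odot>\<^bsub>M\<^esub> x \<in> genmodule R M A))"
  (is "_ \<longleftrightarrow> ?R")
proof
  assume "S_finite R S (M\<lparr>carrier := N\<rparr>)"
  then obtain s F where s: "s \<in> S" and F: "submodule F R M" "F \<subseteq> N"
    and fg: "finitely_generated R (M\<lparr>carrier := F\<rparr>)" and sN: "\<forall>x\<in>N. s \<odot>\<^bsub>M\<^esub> x \<in> F"
    unfolding S_finite_def submodule_restrict_iff[OF N] by (auto simp: image_subset_iff)
  then show ?R
    unfolding finitely_generated_restrict_iff[OF F(1)] by blast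
next
  assume ?R
  then obtain s A where s: "s \<in> S" and A: "finite A" "A \<subseteq> N"
    and sN: "\<forall>x\<in>N. s \<odot>\<^bsub>M\<^esub> x \<in> genmodule R M A" by blast
  have F: "submodule (genmodule R M A) R M"
    using A submoduleE(1)[OF N] by (intro genmodule_submodule) blast
  then have "finitely_generated R (M\<lparr>carrier := genmodule R M A\<rparr>)"
    unfolding finitely_generated_restrict_iff[OF F] using A genmodule_self by blast
  then show "S_finite R S (M\<lparr>carrier := N\<rparr>)"
    unfolding S_finite_def submodule_restrict_iff[OF N]
    using s sN F genmodule_minimal[OF N A(2)] by auto
qed

lemma submodule_ideal_image:
  assumes "ideal J R" "m \<in> carrier M"
  shows "submodule ((\<lambda>c. c \<odot>\<^bsub>M\<^esub> m) ` J) R M"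
proof -
  interpret J: ideal J R by (rule assms(1))
  show ?thesis
    unfolding submodule_iff
  proof (intro conjI ballI)
    show "(\<lambda>c. c \<odot>\<^bsub>M\<^esub> m) ` J \<subseteq> carrier M"
      using assms(2) by auto
    show "\<zero>\<^bsub>M\<^esub> \<in> (\<lambda>c. c \<odot>\<^bsub>M\<^esub> m) ` J"
      using assms(2) by (intro image_eqI[of _ _ \<zero>]) auto
  next
    fix x y assume "x \<in> (\<lambda>c. c \<odot>\<^bsub>M\<^esub> m) ` J" "y \<in> (\<lambda>c. c \<odot>\<^bsub>M\<^esub> m) ` J"
    then obtain c d where "c \<in> J" "d \<in> J" "x = c \<odot>\<^bsub>M\<^esub> m" "y = d \<odot>\<^bsub>M\<^esub> m" by blast
    then show "x \<oplus>\<^bsub>M\<^esub> y \<in> (\<lambda>c. c \<odot>\<^bsub>M\<^esub> m) ` J"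
      using assms(2) by (intro image_eqI[of _ _ "c \<oplus> d"]) (auto simp: smult_l_distr)
  next
    fix a x assume "a \<in> carrier R" "x \<in> (\<lambda>c. c \<odot>\<^bsub>M\<^esub> m) ` J"
    then obtain c where "c \<in> J" "x = c \<odot>\<^bsub>M\<^esub> m" by blast
    then show "a \<odot>\<^bsub>M\<^esub> x \<in> (\<lambda>c. c \<odot>\<^bsub>M\<^esub> m) ` J"
      using assms(2) \<open>a \<in> carrier R\<close>
      by (intro image_eqI[of _ _ "a \<otimes> c"]) (auto simp: smult_assoc1 J.I_l_closed)
  qed
qed

lemma submodule_equalizer:
  assumes a: "a \<in> carrier R" and b: "b \<in> carrier R"
  shows "submodule {x \<in> carrier M. a \<odot>\<^bsub>M\<^esub> x = b \<odot>\<^bsub>M\<^esub> x} R M"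
  unfolding submodule_iff
proof (intro conjI ballI)
  fix c x assume c: "c \<in> carrier R" and "x \<in> {x \<in> carrier M. a \<odot>\<^bsub>M\<^esub> x = b \<odot>\<^bsub>M\<^esub> x}"
  then have x: "x \<in> carrier M" and eq: "a \<odot>\<^bsub>M\<^esub> x = b \<odot>\<^bsub>M\<^esub> x" by auto
  have swap: "d \<odot>\<^bsub>M\<^esub> (c \<odot>\<^bsub>M\<^esub> x) = c \<odot>\<^bsub>M\<^esub> (d \<odot>\<^bsub>M\<^esub> x)" if "d \<in> carrier R" for d
    using that c x by (simp add: smult_assoc1[symmetric] R.m_comm)
  show "c \<odot>\<^bsub>M\<^esub> x \<in> {x \<in> carrier M. a \<odot>\<^bsub>M\<^esub> x = b \<odot>\<^bsub>M\<^esub> x}"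
    using a b c x eq by (simp add: swap)
qed (use a b in \<open>auto simp: smult_r_distr\<close>)

lemma smult_minus_eq_zero_iff:
  assumes "a \<in> carrier R" "b \<in> carrier R" "x \<in> carrier M"
  shows "(a \<ominus> b) \<odot>\<^bsub>M\<^esub> x = \<zero>\<^bsub>M\<^esub> \<longleftrightarrow> a \<odot>\<^bsub>M\<^esub> x = b \<odot>\<^bsub>M\<^esub> x"
proof -
  have "(a \<ominus> b) \<odot>\<^bsub>M\<^esub> x = a \<odot>\<^bsub>M\<^esub> x \<ominus>\<^bsub>M\<^esub> b \<odot>\<^bsub>M\<^esub> x"
    using assms by (simp add: R.minus_eq M.minus_eq smult_l_distr smult_l_minus)
  then show ?thesis
    using assms by (auto simp: M.minus_eq M.r_neg dest: M.minus_equality)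
qed

lemma ideal_annihilating:
  assumes "ideal I R" "X \<subseteq> carrier M"
  shows "ideal {c \<in> I. \<forall>x\<in>X. c \<odot>\<^bsub>M\<^esub> x = \<zero>\<^bsub>M\<^esub>} R" (is "ideal ?J R")
proof -
  interpret I: ideal I R by (rule assms(1))
  interpret RM: module R "ring_as_module R" by (rule R.module_ring_as_module)
  have "submodule ?J R (ring_as_module R)"
    unfolding RM.submodule_iff
    using assms(2) by (auto simp: smult_l_distr smult_assoc1 I.I_l_closed subset_iff)
  then show ?thesis
    by (simp add: R.submodule_ring_as_module_iff)
qed

text \<open>\<open>S\<close>-finiteness of the image of \<open>I\<close> under \<open>r \<mapsto> (r x)\<^bsub>x \<in> X\<^esub>\<close>.  The generators of that image
  are lifted to \<open>I\<close>, which is what allows the induction over \<open>X\<close> to accumulate them.\<close>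

lemma ideal_S_finite_modulo_annihilator:
  assumes S: "submonoid S R" and noeth: "S_noetherian_module R S M"
    and I: "ideal I R" and X: "finite X" "X \<subseteq> carrier M"
  shows "\<exists>s\<in>S. \<exists>A. finite A \<and> A \<subseteq> I \<and>
    (\<forall>r\<in>I. \<exists>b\<in>Idl A. \<forall>x\<in>X. (s \<otimes> r) \<odot>\<^bsub>M\<^esub> x = b \<odot>\<^bsub>M\<^esub> x)"
  using X
proof (induction X)
  case empty
  have "\<zero> \<in> Idl {}"
    by (simp add: R.genideal_ideal additive_subgroup.zero_closed ideal.axioms(1))
  then show ?case
    using submonoid.one_closed[OF S] by (intro bexI[of _ \<one>] exI[of _ "{}"]) auto
next
  case (insert m X)
  then have m: "m \<in> carrier M" and X: "X \<subseteq> carrier M" by auto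
  from insert obtain s A where s: "s \<in> S" and A: "finite A" "A \<subseteq> I"
    and sA: "\<forall>r\<in>I. \<exists>b\<in>Idl A. \<forall>x\<in>X. (s \<otimes> r) \<odot>\<^bsub>M\<^esub> x = b \<odot>\<^bsub>M\<^esub> x" by blast
  interpret I: ideal I R by (rule I)
  define J where "J = {c \<in> I. \<forall>x\<in>X. c \<odot>\<^bsub>M\<^esub> x = \<zero>\<^bsub>M\<^esub>}"
  have J: "ideal J R"
    unfolding J_def by (rule ideal_annihilating[OF I X])
  note Jm = submodule_ideal_image[OF J m]
  have "S_finite R S (M\<lparr>carrier := (\<lambda>c. c \<odot>\<^bsub>M\<^esub> m) ` J\<rparr>)"
    using noeth Jm unfolding S_noetherian_module_def by blast
  then obtain s' B where s': "s' \<in> S" and B: "finite B" "B \<subseteq> (\<lambda>c. c \<odot>\<^bsub>M\<^esub> m) ` J"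
    and s'B: "\<forall>x\<in>(\<lambda>c. c \<odot>\<^bsub>M\<^esub> m) ` J. s' \<odot>\<^bsub>M\<^esub> x \<in> genmodule R M B"
    unfolding S_finite_submodule_iff[OF Jm] by blast
  obtain C where C: "C \<subseteq> J" "finite C" "B = (\<lambda>c. c \<odot>\<^bsub>M\<^esub> m) ` C"
    using finite_subset_image[OF B] by blast
  have C_I: "C \<subseteq> I" using C(1) unfolding J_def by blast
  have carr: "s \<in> carrier R" "s' \<in> carrier R" "I \<subseteq> carrier R"
    using s s' submonoid.subset[OF S] I.a_subset by auto
  have AC: "ideal (Idl (A \<union> C)) R" and C_ideal: "ideal (Idl C) R"
    using A C_I carr by (auto intro!: R.genideal_ideal)
  interpret AC: ideal "Idl (A \<union> C)" R by (rule AC)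
  have AC_self: "A \<union> C \<subseteq> Idl (A \<union> C)"
    using A C_I carr by (intro R.genideal_self) auto
  have A_AC: "Idl A \<subseteq> Idl (A \<union> C)" and C_AC: "Idl C \<subseteq> Idl (A \<union> C)"
    using AC_self by (auto intro!: R.genideal_minimal[OF AC])
  have A_I: "Idl A \<subseteq> I"
    using A by (intro R.genideal_minimal[OF I])
  have C_J: "Idl C \<subseteq> J"
    by (rule R.genideal_minimal[OF J C(1)])
  have gen_B: "genmodule R M B \<subseteq> (\<lambda>c. c \<odot>\<^bsub>M\<^esub> m) ` (Idl C)"
    unfolding C(3) using R.genideal_self[of C] C_I carr
    by (intro genmodule_minimal submodule_ideal_image C_ideal m image_mono) auto
  have "\<exists>b\<in>Idl (A \<union> C). \<forall>x\<in>insert m X. (s' \<otimes> s \<otimes> r) \<odot>\<^bsub>M\<^esub> x = b \<odot>\<^bsub>M\<^esub> x"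
    if r: "r \<in> I" for r
  proof -
    obtain b where b: "b \<in> Idl A" and rb: "\<forall>x\<in>X. (s \<otimes> r) \<odot>\<^bsub>M\<^esub> x = b \<odot>\<^bsub>M\<^esub> x"
      using sA r by blast
    have rc: "r \<in> carrier R" and bc: "b \<in> carrier R"
      using r b A_I carr by auto
    have "s \<otimes> r \<ominus> b \<in> I"
      using r b A_I carr bc unfolding R.minus_eq by (auto intro!: I.a_closed I.I_l_closed)
    then have d: "s \<otimes> r \<ominus> b \<in> J"
      unfolding J_def using rb X rc bc carr by (auto simp: smult_minus_eq_zero_iff)
    then have "s' \<odot>\<^bsub>M\<^esub> ((s \<otimes> r \<ominus> b) \<odot>\<^bsub>M\<^esub> m) \<in> genmodule R M B"
      using s'B by blast
    then obtain c where c: "c \<in> Idl C"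
      and eq: "s' \<odot>\<^bsub>M\<^esub> ((s \<otimes> r \<ominus> b) \<odot>\<^bsub>M\<^esub> m) = c \<odot>\<^bsub>M\<^esub> m"
      using gen_B by blast
    have cJ: "c \<in> J" and cc: "c \<in> carrier R"
      using c C_J carr unfolding J_def by auto
    \<comment> \<open>On \<open>X\<close> both sides are zero, because \<open>J\<close> annihilates \<open>X\<close>; for \<open>m\<close> this is the choice of \<open>c\<close>.\<close>
    have agree: "(s' \<otimes> (s \<otimes> r \<ominus> b)) \<odot>\<^bsub>M\<^esub> x = c \<odot>\<^bsub>M\<^esub> x" if "x \<in> insert m X" for x
      using that d cJ eq X m carr rc bc unfolding J_def by (auto simp: smult_assoc1)
    have split: "s' \<otimes> s \<otimes> r = s' \<otimes> (s \<otimes> r \<ominus> b) \<oplus> s' \<otimes> b"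
      using carr rc bc by algebra
    have "(s' \<otimes> s \<otimes> r) \<odot>\<^bsub>M\<^esub> x = (c \<oplus> s' \<otimes> b) \<odot>\<^bsub>M\<^esub> x" if "x \<in> insert m X" for x
    proof -
      have "x \<in> carrier M" using that m X by auto
      then show ?thesis
        unfolding split using carr rc bc cc agree[OF that] by (simp add: smult_l_distr)
    qed
    moreover have "c \<oplus> s' \<otimes> b \<in> Idl (A \<union> C)"
      using b c A_AC C_AC carr by (auto intro!: AC.a_closed AC.I_l_closed)
    ultimately show ?thesis by blast
  qed
  moreover have "s' \<otimes> s \<in> S"
    using s s' by (rule submonoid.m_closed[OF S, rotated])
  moreover have "finite (A \<union> C)" "A \<union> C \<subseteq> I"
    using A C C_I by auto
  ultimately show ?case by blast
qed

end

lemma (in cring) genmodule_ring_as_module: "genmodule R (ring_as_module R) A = Idl A"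
  unfolding genmodule_def genideal_def submodule_ring_as_module_iff ..

theorem theorem2p9:
  fixes R :: "('a, 'c) ring_scheme" and M :: "('a, 'b, 'd) module_scheme" and S :: "'a set"
  assumes "cring R"
    and "submonoid S R"
    and "module R M"
    and "S_faithful R S M"
    and "S_noetherian_module R S M"
  shows "S_noetherian_ring R S"
proof -
  interpret module R M by (rule assms(3))
  interpret S: submonoid S R by (rule assms(2))
  interpret RM: module R "ring_as_module R" by (rule R.module_ring_as_module)
  obtain t where t: "t \<in> S" "\<And>a. a \<in> annihilator R M \<Longrightarrow> t \<otimes>\<^bsub>R\<^esub> a = \<zero>\<^bsub>R\<^esub>"
    using assms(4) unfolding S_faithful_def by blast
  have "S_finite R S (M\<lparr>carrier := carrier M\<rparr>)"
    using assms(5) carrier_is_submodule unfolding S_noetherian_module_def by blast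
  then obtain s X where s: "s \<in> S" and X: "finite X" "X \<subseteq> carrier M"
    and sX: "\<forall>y\<in>carrier M. s \<odot>\<^bsub>M\<^esub> y \<in> genmodule R M X"
    unfolding S_finite_submodule_iff[OF carrier_is_submodule] by blast
  have "S_finite R S (ring_as_module R\<lparr>carrier := I\<rparr>)"
    if "submodule I R (ring_as_module R)" for I
  proof -
    have I: "ideal I R"
      using that by (simp add: R.submodule_ring_as_module_iff)
    obtain u A where u: "u \<in> S" and A: "finite A" "A \<subseteq> I"
      and uA: "\<forall>r\<in>I. \<exists>b\<in>Idl\<^bsub>R\<^esub> A. \<forall>x\<in>X. (u \<otimes>\<^bsub>R\<^esub> r) \<odot>\<^bsub>M\<^esub> x = b \<odot>\<^bsub>M\<^esub> x"
      using ideal_S_finite_modulo_annihilator[OF assms(2,5) I X] by blast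
    have A_ideal: "ideal (Idl\<^bsub>R\<^esub> A) R"
      using A I by (intro R.genideal_ideal) (auto dest: ideal.Icarr)
    have "t \<otimes>\<^bsub>R\<^esub> s \<otimes>\<^bsub>R\<^esub> u \<otimes>\<^bsub>R\<^esub> r \<in> Idl\<^bsub>R\<^esub> A" if r: "r \<in> I" for r
    proof -
      obtain b where b: "b \<in> Idl\<^bsub>R\<^esub> A"
        and eq: "\<forall>x\<in>X. (u \<otimes>\<^bsub>R\<^esub> r) \<odot>\<^bsub>M\<^esub> x = b \<odot>\<^bsub>M\<^esub> x"
        using uA r by blast
      have carr: "t \<in> carrier R" "s \<in> carrier R" "u \<in> carrier R" "r \<in> carrier R" "b \<in> carrier R"
        using t(1) s u S.subset ideal.Icarr[OF I r] ideal.Icarr[OF A_ideal b] by auto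
      define d where "d = u \<otimes>\<^bsub>R\<^esub> r \<ominus>\<^bsub>R\<^esub> b"
      have d: "d \<in> carrier R" unfolding d_def using carr by simp
      have gen: "genmodule R M X \<subseteq> {y \<in> carrier M. (u \<otimes>\<^bsub>R\<^esub> r) \<odot>\<^bsub>M\<^esub> y = b \<odot>\<^bsub>M\<^esub> y}"
        using eq X carr by (intro genmodule_minimal submodule_equalizer) auto
      \<comment> \<open>Agreement on the generators \<open>X\<close> extends to their span, which contains \<open>s M\<close>.\<close>
      have "d \<odot>\<^bsub>M\<^esub> (s \<odot>\<^bsub>M\<^esub> y) = \<zero>\<^bsub>M\<^esub>" if "y \<in> carrier M" for y
        using gen sX that carr unfolding d_def by (auto simp: smult_minus_eq_zero_iff)
      then have "d \<otimes>\<^bsub>R\<^esub> s \<in> annihilator R M"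
        unfolding annihilator_def using d carr by (simp add: smult_assoc1)
      then have "t \<otimes>\<^bsub>R\<^esub> (d \<otimes>\<^bsub>R\<^esub> s) = \<zero>\<^bsub>R\<^esub>"
        by (rule t(2))
      moreover have "t \<otimes>\<^bsub>R\<^esub> s \<otimes>\<^bsub>R\<^esub> u \<otimes>\<^bsub>R\<^esub> r = t \<otimes>\<^bsub>R\<^esub> (d \<otimes>\<^bsub>R\<^esub> s) \<oplus>\<^bsub>R\<^esub> t \<otimes>\<^bsub>R\<^esub> s \<otimes>\<^bsub>R\<^esub> b"
        unfolding d_def using carr by algebra
      ultimately have "t \<otimes>\<^bsub>R\<^esub> s \<otimes>\<^bsub>R\<^esub> u \<otimes>\<^bsub>R\<^esub> r = t \<otimes>\<^bsub>R\<^esub> s \<otimes>\<^bsub>R\<^esub> b"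
        using carr by simp
      then show ?thesis
        using ideal.I_l_closed[OF A_ideal b] carr by simp
    qed
    moreover have "t \<otimes>\<^bsub>R\<^esub> s \<otimes>\<^bsub>R\<^esub> u \<in> S"
      using t(1) s u by simp
    ultimately show ?thesis
      unfolding RM.S_finite_submodule_iff[OF that] R.genmodule_ring_as_module
      using A by auto
  qed
  then show ?thesis
    unfolding S_noetherian_ring_def S_noetherian_module_def by blast
qed

end
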